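(* Let $n\ge 2$, and fix a column index $i\in\{1,\dots,n\}$ and $k\in\{0,\dots,n-1\}$. Then $$\sum_{\substack{\mathbf k'\in\{0,\dots,n-1\}^n\\ k'_i=k}} E_n(\mathbf k')=\frac{L_n}{n!}\,A(n,k).$$
   Context: $[n]=\{1,\dots,n\}$. An order-$n$ Latin square is an $n\times n$ matrix $L=(L(i,j))_{1\le i,j\le n}$ with entries in $[n]$ such that every row and every column is a permutation of $[n]$; $L_n$ denotes the number of order-$n$ Latin squares. An ascent of a permutation $\pi$ of $[n]$ is an index $i\in\{1,\dots,n-1\}$ with $\pi(i)<\pi(i+1)$. The classical Eulerian number $A(n,k)$ is the number of permutations of $[n]$ with exactly $k$ ascents. For a Latin square $L$ and $1\le i\le n$, $k_i(L)$ is the number of ascents of the $i$-th column $(L(1,i),\dots,L(n,i))$ viewed as a permutation of $[n]$. For $\mathbf k=(k_1,\dots,k_n)\in\{0,\dots,n-1\}^n$, the Latin Eulerian number $E_n(\mathbf k)=E_n(k_1,\dots,k_n)$ is the number of order-$n$ Latin squares $L$ with $k_i(L)=k_i$ for all $i=1,\dots,n$. *)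

theory Defs
  imports Complex_Main "HOL-Library.FuncSet" "HOL-Combinatorics.Permutations"
begin

(* An n x n matrix with entries in {1..n} is an extensional function (value
   "undefined" outside the index range), so that distinct functions are
   distinct matrices and the cardinalities below count matrices. *)
definition latin_squares :: "nat \<Rightarrow> (nat \<Rightarrow> nat \<Rightarrow> nat) set" where
  "latin_squares n =
     {L \<in> {1..n} \<rightarrow>\<^sub>E ({1..n} \<rightarrow>\<^sub>E {1..n}).
        (\<forall>i\<in>{1..n}. bij_betw (\<lambda>j. L i j) {1..n} {1..n}) \<and>
        (\<forall>j\<in>{1..n}. bij_betw (\<lambda>i. L i j) {1..n} {1..n})}"

definition num_latin_squares :: "nat \<Rightarrow> nat" where
  "num_latin_squares n = card (latin_squares n)"

(* The argument p is used only through its values on {1..n}; this lets one notion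
   serve both for functions permuting {1..n} (identity elsewhere) and for the
   columns of an extensional matrix. *)
definition ascents :: "nat \<Rightarrow> (nat \<Rightarrow> nat) \<Rightarrow> nat set" where
  "ascents n p = {i \<in> {1..<n}. p i < p (i + 1)}"

definition eulerian :: "nat \<Rightarrow> nat \<Rightarrow> nat" where
  "eulerian n k = card {p. p permutes {1..n} \<and> card (ascents n p) = k}"

definition column_ascents :: "nat \<Rightarrow> (nat \<Rightarrow> nat \<Rightarrow> nat) \<Rightarrow> nat \<Rightarrow> nat" where
  "column_ascents n L i = card (ascents n (\<lambda>r. L r i))"

definition latin_eulerian :: "nat \<Rightarrow> (nat \<Rightarrow> nat) \<Rightarrow> nat" where
  "latin_eulerian n \<kappa> =
     card {L \<in> latin_squares n. \<forall>i\<in>{1..n}. column_ascents n L i = \<kappa> i}"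

end

theory Submission
  imports Defs
begin

text \<open>
  The symmetric group acts on Latin squares by renaming symbols, and on a fixed column \<open>i\<close> a
  renaming \<open>\<sigma>\<close> turns the permutation \<open>p\<close> displayed there into \<open>\<sigma> \<circ> p\<close>. Left multiplication is
  transitive on permutations, so every permutation of \<open>{1..n}\<close> is displayed in column \<open>i\<close> by the
  same number of Latin squares (\<open>card_column_fibre_eq\<close>), which must then be \<open>L\<^sub>n / n!\<close>. Hence the number
  of squares whose column \<open>i\<close> lies in a prescribed set of permutations is \<open>L\<^sub>n / n!\<close> times the size
  of that set (\<open>card_latin_squares_column_in\<close>); the set of permutations with \<open>k\<close> ascents gives the
  right-hand side. On the left, summing over all ascent profiles with \<open>i\<close>-th entry \<open>k\<close> forgets the
  ascents of the other columns, so the sum counts exactly these squares.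
\<close>

text \<open>The identity outside \<open>{1..n}\<close> makes a column of a Latin square a permutation in the
  sense of \<open>permutes\<close>.\<close>
definition column_perm :: "nat \<Rightarrow> (nat \<Rightarrow> nat \<Rightarrow> nat) \<Rightarrow> nat \<Rightarrow> nat \<Rightarrow> nat" where
  "column_perm n L i = (\<lambda>r. if r \<in> {1..n} then L r i else r)"

definition column_fibre :: "nat \<Rightarrow> nat \<Rightarrow> (nat \<Rightarrow> nat) \<Rightarrow> (nat \<Rightarrow> nat \<Rightarrow> nat) set" where
  "column_fibre n i p = {L \<in> latin_squares n. column_perm n L i = p}"

definition rename_symbols ::
    "nat \<Rightarrow> (nat \<Rightarrow> nat) \<Rightarrow> (nat \<Rightarrow> nat \<Rightarrow> nat) \<Rightarrow> nat \<Rightarrow> nat \<Rightarrow> nat" where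
  "rename_symbols n \<sigma> L = (\<lambda>r\<in>{1..n}. \<lambda>c\<in>{1..n}. \<sigma> (L r c))"

lemma finite_latin_squares: "finite (latin_squares n)"
  unfolding latin_squares_def by (intro finite_Collect_conjI disjI1 finite_PiE) (auto intro: finite_PiE)

lemma card_eq_sum_fibres:
  assumes "finite A" "finite B" "g ` A \<subseteq> B"
  shows "card A = (\<Sum>y\<in>B. card {x \<in> A. g x = y})"
  using sum.group[OF assms, of "\<lambda>_. 1::nat"] by simp

lemma column_perm_permutes:
  assumes "L \<in> latin_squares n" "i \<in> {1..n}"
  shows "column_perm n L i permutes {1..n}"
proof (rule bij_imp_permutes)
  have "bij_betw (\<lambda>r. L r i) {1..n} {1..n}"
    using assms by (auto simp: latin_squares_def)
  then show "bij_betw (column_perm n L i) {1..n} {1..n}"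
    by (rule bij_betw_cong[THEN iffD1, rotated]) (simp add: column_perm_def)
qed (auto simp: column_perm_def)

lemma ascents_column_perm: "ascents n (column_perm n L i) = ascents n (\<lambda>r. L r i)"
  unfolding ascents_def column_perm_def by auto

lemma rename_symbols_latin:
  assumes "\<sigma> permutes {1..n}" "L \<in> latin_squares n"
  shows "rename_symbols n \<sigma> L \<in> latin_squares n"
proof -
  have L: "L r c \<in> {1..n}" if "r \<in> {1..n}" "c \<in> {1..n}" for r c
    using assms(2) that unfolding latin_squares_def by (auto simp: PiE_iff)
  have \<sigma>: "bij_betw \<sigma> {1..n} {1..n}"
    using assms(1) by (rule permutes_imp_bij)
  have "bij_betw (\<lambda>c. rename_symbols n \<sigma> L r c) {1..n} {1..n}" if r: "r \<in> {1..n}" for r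
  proof -
    have "bij_betw (\<lambda>c. L r c) {1..n} {1..n}"
      using assms(2) r by (auto simp: latin_squares_def)
    from bij_betw_trans[OF this \<sigma>] show ?thesis
      by (rule bij_betw_cong[THEN iffD1, rotated]) (use r in \<open>simp add: rename_symbols_def\<close>)
  qed
  moreover have "bij_betw (\<lambda>r. rename_symbols n \<sigma> L r c) {1..n} {1..n}" if c: "c \<in> {1..n}" for c
  proof -
    have "bij_betw (\<lambda>r. L r c) {1..n} {1..n}"
      using assms(2) c by (auto simp: latin_squares_def)
    from bij_betw_trans[OF this \<sigma>] show ?thesis
      by (rule bij_betw_cong[THEN iffD1, rotated]) (use c in \<open>simp add: rename_symbols_def\<close>)
  qed
  moreover have "rename_symbols n \<sigma> L \<in> {1..n} \<rightarrow>\<^sub>E ({1..n} \<rightarrow>\<^sub>E {1..n})"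
    unfolding rename_symbols_def
    by (intro restrict_PiE_iff[THEN iffD2] ballI bij_betw_apply[OF \<sigma>] L)
  ultimately show ?thesis
    unfolding latin_squares_def by blast
qed

lemma inj_on_rename_symbols:
  assumes "\<sigma> permutes {1..n}"
  shows "inj_on (rename_symbols n \<sigma>) (latin_squares n)"
proof (rule inj_onI)
  fix L M
  assume LM: "L \<in> latin_squares n" "M \<in> latin_squares n"
    and eq: "rename_symbols n \<sigma> L = rename_symbols n \<sigma> M"
  have entries: "L r c = M r c" if "r \<in> {1..n}" "c \<in> {1..n}" for r c
    using fun_cong[OF fun_cong[OF eq], of r c] that permutes_inj[OF assms]
    by (simp add: rename_symbols_def inj_eq)
  have L: "L \<in> {1..n} \<rightarrow>\<^sub>E ({1..n} \<rightarrow>\<^sub>E {1..n})" and M: "M \<in> {1..n} \<rightarrow>\<^sub>E ({1..n} \<rightarrow>\<^sub>E {1..n})"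
    using LM by (auto simp: latin_squares_def)
  show "L = M"
  proof (rule PiE_ext[OF L M])
    fix r assume r: "r \<in> {1..n}"
    show "L r = M r"
      using PiE_mem[OF L r] PiE_mem[OF M r] by (rule PiE_ext) (rule entries[OF r])
  qed
qed

lemma column_perm_rename_symbols:
  assumes "\<sigma> permutes {1..n}" "i \<in> {1..n}"
  shows "column_perm n (rename_symbols n \<sigma> L) i = \<sigma> \<circ> column_perm n L i"
proof
  fix r
  show "column_perm n (rename_symbols n \<sigma> L) i r = (\<sigma> \<circ> column_perm n L i) r"
    using assms permutes_not_in[OF assms(1), of r]
    by (cases "r \<in> {1..n}") (auto simp: column_perm_def rename_symbols_def)
qed

lemma card_column_fibre_le:
  assumes "\<sigma> permutes {1..n}" "i \<in> {1..n}"
  shows "card (column_fibre n i p) \<le> card (column_fibre n i (\<sigma> \<circ> p))"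
proof (rule card_inj_on_le)
  show "inj_on (rename_symbols n \<sigma>) (column_fibre n i p)"
    using inj_on_rename_symbols[OF assms(1)]
    by (rule inj_on_subset) (auto simp: column_fibre_def)
  show "rename_symbols n \<sigma> ` column_fibre n i p \<subseteq> column_fibre n i (\<sigma> \<circ> p)"
    using assms by (auto simp: column_fibre_def rename_symbols_latin column_perm_rename_symbols)
  show "finite (column_fibre n i (\<sigma> \<circ> p))"
    by (simp add: column_fibre_def finite_latin_squares)
qed

text \<open>Renaming by \<open>p\<close> carries the squares with identity column into those with column \<open>p\<close>, and
  renaming by the inverse of \<open>p\<close> carries them back.\<close>
lemma card_column_fibre_eq:
  assumes "p permutes {1..n}" "i \<in> {1..n}"
  shows "card (column_fibre n i p) = card (column_fibre n i id)"
  using card_column_fibre_le[OF assms, of id]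
    card_column_fibre_le[OF permutes_inv[OF assms(1)] assms(2), of p]
    permutes_inv_o(2)[OF assms(1)]
  by simp

text \<open>Taking \<open>P\<close> to be the set of all permutations of \<open>{1..n}\<close> identifies the common fibre size
  as \<open>L\<^sub>n / n!\<close>.\<close>
lemma card_latin_squares_column_in:
  assumes "i \<in> {1..n}" and P: "P \<subseteq> {p. p permutes {1..n}}"
  shows "card {L \<in> latin_squares n. column_perm n L i \<in> P} = card P * card (column_fibre n i id)"
proof -
  let ?A = "{L \<in> latin_squares n. column_perm n L i \<in> P}"
  have "finite P"
    using P by (rule finite_subset) (simp add: finite_permutations)
  then have "card ?A = (\<Sum>p\<in>P. card {L \<in> ?A. column_perm n L i = p})"
    by (intro card_eq_sum_fibres) (auto simp: finite_latin_squares)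
  also have "\<dots> = (\<Sum>p\<in>P. card (column_fibre n i id))"
  proof (rule sum.cong)
    fix p assume p: "p \<in> P"
    have "{L \<in> ?A. column_perm n L i = p} = column_fibre n i p"
      using p by (auto simp: column_fibre_def)
    moreover have "p permutes {1..n}"
      using p P by blast
    then have "card (column_fibre n i p) = card (column_fibre n i id)"
      using assms(1) by (rule card_column_fibre_eq)
    ultimately show "card {L \<in> ?A. column_perm n L i = p} = card (column_fibre n i id)"
      by (simp only:)
  qed simp
  finally show ?thesis
    by simp
qed

lemma num_latin_squares_eq_fact_mult:
  assumes "i \<in> {1..n}"
  shows "num_latin_squares n = fact n * card (column_fibre n i id)"
proof -
  have "{L \<in> latin_squares n. column_perm n L i \<in> {p. p permutes {1..n}}} = latin_squares n"
    using column_perm_permutes[OF _ assms] by auto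
  then have "num_latin_squares n = card {p. p permutes {1..n}} * card (column_fibre n i id)"
    using card_latin_squares_column_in[OF assms order_refl] by (simp only: num_latin_squares_def)
  then show ?thesis
    by (simp add: card_permutations)
qed

lemma card_column_ascents_eq:
  assumes "i \<in> {1..n}"
  shows "card {L \<in> latin_squares n. column_ascents n L i = k}
           = eulerian n k * card (column_fibre n i id)"
proof -
  let ?P = "{p. p permutes {1..n} \<and> card (ascents n p) = k}"
  have "{L \<in> latin_squares n. column_ascents n L i = k}
          = {L \<in> latin_squares n. column_perm n L i \<in> ?P}"
    using column_perm_permutes[OF _ assms] by (auto simp: column_ascents_def ascents_column_perm)
  then show ?thesis
    using card_latin_squares_column_in[OF assms, of ?P] by (auto simp: eulerian_def)
qed

lemma column_ascents_le: "column_ascents n L c \<le> n - 1"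
proof -
  have "card (ascents n (\<lambda>r. L r c)) \<le> card {1..<n}"
    by (rule card_mono) (auto simp: ascents_def)
  then show ?thesis
    by (simp add: column_ascents_def)
qed

lemma sum_latin_eulerian_eq_card:
  assumes "i \<in> {1..n}"
  shows "(\<Sum>\<kappa> \<in> {\<kappa> \<in> {1..n} \<rightarrow>\<^sub>E {0..n - 1}. \<kappa> i = k}. latin_eulerian n \<kappa>)
           = card {L \<in> latin_squares n. column_ascents n L i = k}"
proof -
  let ?A = "{L \<in> latin_squares n. column_ascents n L i = k}"
  let ?B = "{\<kappa> \<in> {1..n} \<rightarrow>\<^sub>E {0..n - 1}. \<kappa> i = k}"
  let ?g = "\<lambda>L. restrict (column_ascents n L) {1..n}"
  have "card ?A = (\<Sum>\<kappa>\<in>?B. card {L \<in> ?A. ?g L = \<kappa>})"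
  proof (rule card_eq_sum_fibres)
    show "?g ` ?A \<subseteq> ?B"
      using assms column_ascents_le by auto
  qed (simp_all add: finite_latin_squares finite_PiE)
  also have "\<dots> = (\<Sum>\<kappa>\<in>?B. latin_eulerian n \<kappa>)"
  proof (rule sum.cong)
    fix \<kappa> assume \<kappa>: "\<kappa> \<in> ?B"
    have "?g L = \<kappa> \<longleftrightarrow> (\<forall>c\<in>{1..n}. column_ascents n L c = \<kappa> c)" for L
      using \<kappa> by (auto simp: fun_eq_iff PiE_iff extensional_def)
    then have "{L \<in> ?A. ?g L = \<kappa>}
        = {L \<in> latin_squares n. \<forall>c\<in>{1..n}. column_ascents n L c = \<kappa> c}"
      using \<kappa> assms by auto
    then show "card {L \<in> ?A. ?g L = \<kappa>} = latin_eulerian n \<kappa>"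
      by (simp add: latin_eulerian_def)
  qed simp
  finally show ?thesis
    by simp
qed

theorem theorem2p8:
  fixes n i k :: nat
  assumes "n \<ge> 2" and "i \<in> {1..n}" and "k \<in> {0..n - 1}"
  shows "(\<Sum>\<kappa> \<in> {\<kappa> \<in> {1..n} \<rightarrow>\<^sub>E {0..n - 1}. \<kappa> i = k}. real (latin_eulerian n \<kappa>))
           = real (num_latin_squares n) / fact n * real (eulerian n k)"
proof -
  have "(\<Sum>\<kappa> \<in> {\<kappa> \<in> {1..n} \<rightarrow>\<^sub>E {0..n - 1}. \<kappa> i = k}. real (latin_eulerian n \<kappa>))
          = real (eulerian n k * card (column_fibre n i id))"
    unfolding of_nat_sum[symmetric] sum_latin_eulerian_eq_card[OF assms(2)]
      card_column_ascents_eq[OF assms(2)] ..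
  also have "\<dots> = real (num_latin_squares n) / fact n * real (eulerian n k)"
    unfolding num_latin_squares_eq_fact_mult[OF assms(2)] by simp
  finally show ?thesis .
qed

end
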